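(* Let $n,m,N\in\mathbb{N}$ and $B_1,\ldots,B_N\in\mathbb{R}^{n\times m}$. Consider the uncertain system $\dot{\sigma}=Bu$, where $\sigma\in\mathbb{R}^n$ is the state, $u\in\mathbb{R}^m$ is the input, and $B$ is a constant but unknown matrix in the convex hull $\mathrm{co}\{B_1,\ldots,B_N\}$, together with the controller $u=K\,\mathrm{sgn}(\sigma)$, $K\in\mathbb{R}^{m\times n}$. Let $\xi>0$ be given. Suppose there exist diagonal matrices $W\in\mathbb{R}^{n\times n}$ and $X\in\mathbb{R}^{n\times n}$, a symmetric matrix $R\in\mathbb{R}^{n\times n}$, and a full matrix $Z\in\mathbb{R}^{m\times n}$ such that $$W>0,\qquad R>0,$$ $$\begin{bmatrix} B_iZ+Z^\top B_i^\top+R & W-X+\xi Z^\top B_i^\top\\ W-X+\xi B_iZ & -2\xi X\end{bmatrix}<0\qquad\text{for all } i\in\{1,\ldots,N\}.$$ Then, with $K=ZX^{-1}$, for every $B\in\mathrm{co}\{B_1,\ldots,B_N\}$ the origin of the closed-loop system $$\dot{\sigma}=BK\,\mathrm{sgn}(\sigma)$$ is globally asymptotically stable.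
   Context: The convex hull is $\mathrm{co}\{B_1,\ldots,B_N\}=\{\sum_{i=1}^N\alpha_iB_i:\alpha_i\ge 0,\ \sum_{i=1}^N\alpha_i=1\}$; the uncertain parameter vector $\alpha$ is constant in time. The sign function acts element-wise: $\mathrm{sgn}(\sigma)=(\mathrm{sgn}(\sigma_1),\ldots,\mathrm{sgn}(\sigma_n))$. For a symmetric matrix $M$, $M>0$ (respectively $M<0$) means that $M$ is positive (respectively negative) definite. "Full matrix" means that no structure (such as symmetry or diagonality) is imposed on $Z$. Since the right-hand side of the closed-loop system is discontinuous, its solutions are understood in the sense of Filippov, i.e. absolutely continuous functions $\sigma(t)$ satisfying for almost every $t$ the differential inclusion $\dot\sigma(t)\in F(\sigma(t))$, where $F$ is the Filippov set-valued regularization of $\sigma\mapsto BK\,\mathrm{sgn}(\sigma)$; explicitly, $F(\sigma)=\{BKv: v_i=\mathrm{sgn}(\sigma_i)\text{ if }\sigma_i\neq 0,\ v_i\in[-1,1]\text{ if }\sigma_i=0\}$. Global asymptotic stability of the origin (Lyapunov stability and convergence to the origin from every initial condition) refers to all such solutions. *)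

theory Defs
  imports "HOL-Analysis.Analysis"
begin

definition diagonal_matrix :: "real^'n^'n \<Rightarrow> bool" where
  "diagonal_matrix M \<longleftrightarrow> (\<forall>i j. i \<noteq> j \<longrightarrow> M $ i $ j = 0)"

definition symmetric_matrix :: "real^'n^'n \<Rightarrow> bool" where
  "symmetric_matrix M \<longleftrightarrow> transpose M = M"

definition pos_definite :: "real^'n^'n \<Rightarrow> bool" where
  "pos_definite M \<longleftrightarrow> symmetric_matrix M \<and> (\<forall>x. x \<noteq> 0 \<longrightarrow> x \<bullet> (M *v x) > 0)"

definition neg_definite :: "real^'n^'n \<Rightarrow> bool" where
  "neg_definite M \<longleftrightarrow> symmetric_matrix M \<and> (\<forall>x. x \<noteq> 0 \<longrightarrow> x \<bullet> (M *v x) < 0)"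

text \<open>The matrix with block rows \<open>P Q\<close> and \<open>S T\<close>; the index type \<open>'a + 'b\<close> lists
  the two groups of columns, and \<open>'c + 'd\<close> those of rows.\<close>

definition block_matrix ::
  "real^'a^'c \<Rightarrow> real^'b^'c \<Rightarrow> real^'a^'d \<Rightarrow> real^'b^'d \<Rightarrow> real^('a + 'b)^('c + 'd)" where
  "block_matrix P Q S T = (\<chi> i j.
     case i of
       Inl r \<Rightarrow> (case j of Inl c \<Rightarrow> P $ r $ c | Inr c \<Rightarrow> Q $ r $ c)
     | Inr r \<Rightarrow> (case j of Inl c \<Rightarrow> S $ r $ c | Inr c \<Rightarrow> T $ r $ c))"

text \<open>On vectors, the library's \<^const>\<open>sgn\<close> is normalisation by the Euclidean norm, so the
  element-wise sign function needs a constant of its own.\<close>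

definition vec_sgn :: "real^'n \<Rightarrow> real^'n" where
  "vec_sgn x = (\<chi> i. sgn (x $ i))"

text \<open>The epsilon-delta definition of absolute continuity on an interval \<open>S\<close> of the real line.
  The members \<open>k\<close> of a division are finitely many closed intervals \<open>[Inf k, Sup k]\<close> with
  pairwise disjoint interiors.\<close>

definition absolutely_continuous_on :: "real set \<Rightarrow> (real \<Rightarrow> 'a::euclidean_space) \<Rightarrow> bool" where
  "absolutely_continuous_on S f \<longleftrightarrow>
     (\<forall>\<epsilon>>0. \<exists>\<delta>>0. \<forall>D T. D division_of T \<and> T \<subseteq> S \<and> (\<Sum>k\<in>D. Sup k - Inf k) < \<delta> \<longrightarrow>
        (\<Sum>k\<in>D. norm (f (Sup k) - f (Inf k))) < \<epsilon>)"

definition inclusion_solution ::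
  "('a::euclidean_space \<Rightarrow> 'a set) \<Rightarrow> (real \<Rightarrow> 'a) \<Rightarrow> bool" where
  "inclusion_solution F \<sigma> \<longleftrightarrow>
     (\<forall>T>0. absolutely_continuous_on {0..T} \<sigma>) \<and>
     (AE t in lebesgue. t \<ge> 0 \<longrightarrow>
        (\<exists>d \<in> F (\<sigma> t). (\<sigma> has_vector_derivative d) (at t within {0..})))"

definition filippov_regularization ::
  "('a::euclidean_space \<Rightarrow> 'a) \<Rightarrow> 'a \<Rightarrow> 'a set" where
  "filippov_regularization f x =
     (\<Inter>\<delta>\<in>{0<..}. \<Inter>N\<in>{N. negligible N}. closure (convex hull (f ` (ball x \<delta> - N))))"

definition filippov_solution ::
  "('a::euclidean_space \<Rightarrow> 'a) \<Rightarrow> (real \<Rightarrow> 'a) \<Rightarrow> bool" where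
  "filippov_solution f \<sigma> \<longleftrightarrow> inclusion_solution (filippov_regularization f) \<sigma>"

text \<open>Stability properties of the origin of \<open>\<sigma>' = f \<sigma>\<close>, for all Filippov solutions.\<close>

definition lyapunov_stable :: "('a::euclidean_space \<Rightarrow> 'a) \<Rightarrow> bool" where
  "lyapunov_stable f \<longleftrightarrow>
     (\<forall>\<epsilon>>0. \<exists>\<delta>>0. \<forall>\<sigma>. filippov_solution f \<sigma> \<and> norm (\<sigma> 0) < \<delta> \<longrightarrow>
        (\<forall>t\<ge>0. norm (\<sigma> t) < \<epsilon>))"

definition globally_attractive :: "('a::euclidean_space \<Rightarrow> 'a) \<Rightarrow> bool" where
  "globally_attractive f \<longleftrightarrow> (\<forall>\<sigma>. filippov_solution f \<sigma> \<longrightarrow> (\<sigma> \<longlongrightarrow> 0) at_top)"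

definition globally_asymptotically_stable :: "('a::euclidean_space \<Rightarrow> 'a) \<Rightarrow> bool" where
  "globally_asymptotically_stable f \<longleftrightarrow> lyapunov_stable f \<and> globally_attractive f"

text \<open>For \<open>f \<sigma> = A sgn(\<sigma>)\<close> the Filippov regularization has the following explicit form.\<close>

definition sgn_set :: "real^'n \<Rightarrow> (real^'n) set" where
  "sgn_set x = {v. \<forall>i. (x $ i \<noteq> 0 \<longrightarrow> v $ i = sgn (x $ i)) \<and> (x $ i = 0 \<longrightarrow> v $ i \<in> {-1..1})}"

lemma sgn_set_cbox:
  "sgn_set x = cbox (\<chi> i. if x $ i = 0 then -1 else sgn (x $ i))
                    (\<chi> i. if x $ i = 0 then 1 else sgn (x $ i))"
  unfolding sgn_set_def set_eq_iff mem_box_cart by (auto intro: antisym)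

lemma eventually_vec_sgn_in_sgn_set:
  fixes x :: "real^'n"
  shows "\<forall>\<^sub>F y in nhds x. vec_sgn y \<in> sgn_set x"
proof -
  have "\<forall>\<^sub>F y in nhds x. (x $ i \<noteq> 0 \<longrightarrow> sgn (y $ i) = sgn (x $ i))" for i
  proof -
    have lim: "((\<lambda>y. y $ i) \<longlongrightarrow> x $ i) (nhds x)"
      by (intro tendsto_vec_nth filterlim_ident)
    consider "x $ i = 0" | "x $ i > 0" | "x $ i < 0" by linarith
    then show ?thesis
    proof cases
      case 2
      show ?thesis
        using order_tendstoD(1)[OF lim 2] by eventually_elim (use 2 in auto)
    next
      case 3
      show ?thesis
        using order_tendstoD(2)[OF lim 3] by eventually_elim (use 3 in auto)
    qed auto
  qed
  then have "\<forall>\<^sub>F y in nhds x. \<forall>i. (x $ i \<noteq> 0 \<longrightarrow> sgn (y $ i) = sgn (x $ i))"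
    by (intro eventually_all_finite) auto
  then show ?thesis
    by eventually_elim (auto simp: sgn_set_def vec_sgn_def sgn_if)
qed

lemma vertex_in_image:
  fixes x w :: "real^'n"
  assumes w: "w \<in> sgn_set x" "\<And>i. \<bar>w $ i\<bar> = 1" and "d > 0" "negligible N"
  shows "w \<in> vec_sgn ` (ball x d - N)"
proof -
  define U where "U = ball x d \<inter> {z. \<forall>i. z $ i * w $ i > 0}"
  have "open (\<Inter>i. {z. z $ i * w $ i > 0})"
    by (intro open_INT ballI open_Collect_less continuous_intros) auto
  also have "(\<Inter>i. {z. z $ i * w $ i > 0}) = {z. \<forall>i. z $ i * w $ i > 0}"
    by auto
  finally have "open {z. \<forall>i. z $ i * w $ i > 0}" .
  then have "open U"
    by (auto simp: U_def)
  define e where "e = d / (norm w + 1)"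
  have "e > 0" and "e * norm w < d"
    using \<open>d > 0\<close> by (auto simp: e_def field_simps add_nonneg_pos add_pos_nonneg)
  have xw: "x $ i * w $ i \<ge> 0" and ww: "w $ i * w $ i = 1" for i
  proof -
    show "x $ i * w $ i \<ge> 0"
      using w(1) by (cases "x $ i = 0") (auto simp: sgn_set_def sgn_if)
    show "w $ i * w $ i = 1"
      using w(2)[of i] by (metis abs_mult_self_eq mult_1)
  qed
  have "(x + e *\<^sub>R w) $ i * w $ i > 0" for i
  proof -
    have "(x + e *\<^sub>R w) $ i * w $ i = x $ i * w $ i + e * (w $ i * w $ i)"
      by (simp add: algebra_simps)
    then show ?thesis
      using xw[of i] ww[of i] \<open>e > 0\<close> by simp
  qed
  then have "x + e *\<^sub>R w \<in> U"
    using \<open>e > 0\<close> \<open>e * norm w < d\<close> by (auto simp: U_def dist_norm)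
  then have "\<not> negligible U"
    using open_not_negligible[OF \<open>open U\<close>] by blast
  then obtain z where z: "z \<in> U" "z \<notin> N"
    using negligible_subset[OF \<open>negligible N\<close>] by blast
  have "sgn (z $ i) = w $ i" for i
    using z(1) w(2)[of i] by (auto simp: U_def sgn_if abs_if zero_less_mult_iff split: if_splits dest!: spec[of _ i])
  then have "vec_sgn z = w"
    by (simp add: vec_sgn_def vec_eq_iff)
  with z show ?thesis
    by (auto simp: U_def)
qed

lemma sgn_set_subset_convex:
  fixes x :: "real^'n"
  assumes "convex T" and vert: "\<And>w. w \<in> sgn_set x \<Longrightarrow> (\<And>i. \<bar>w $ i\<bar> = 1) \<Longrightarrow> w \<in> T"
  shows "sgn_set x \<subseteq> T"
proof -
  have "v \<in> T" if "finite I" "v \<in> sgn_set x" "\<And>i. i \<notin> I \<Longrightarrow> \<bar>v $ i\<bar> = 1" for I v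
    using that
  proof (induction I arbitrary: v rule: finite_induct)
    case empty
    then show ?case by (intro vert) auto
  next
    case (insert i I)
    show ?case
    proof (cases "x $ i = 0")
      case False
      then have "\<bar>v $ i\<bar> = 1"
        using insert.prems(1) by (auto simp: sgn_set_def sgn_if)
      then show ?thesis
        using insert.prems by (intro insert.IH) (metis insert_iff)+
    next
      case True
      define p where "p s = (\<chi> j. if j = i then s else v $ j)" for s :: real
      have bnd: "v $ i \<in> {-1..1}"
        using True insert.prems(1) by (auto simp: sgn_set_def)
      have "p s \<in> T" if "\<bar>s\<bar> = 1" for s
      proof (rule insert.IH)
        have "s \<in> {-1..1}" using that by auto
        then show "p s \<in> sgn_set x"
          using True insert.prems(1) by (simp add: sgn_set_def p_def)
        show "\<bar>p s $ j\<bar> = 1" if "j \<notin> I" for j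
          using that \<open>\<bar>s\<bar> = 1\<close> insert.prems(2)[of j] by (simp add: p_def)
      qed
      then have "p 1 \<in> T" "p (-1) \<in> T" by auto
      then have "((1 + v $ i) / 2) *\<^sub>R p 1 + ((1 - v $ i) / 2) *\<^sub>R p (-1) \<in> T"
        using bnd by (intro convexD[OF \<open>convex T\<close>]) (auto simp: field_simps)
      also have "((1 + v $ i) / 2) *\<^sub>R p 1 + ((1 - v $ i) / 2) *\<^sub>R p (-1) = v"
        by (auto simp: vec_eq_iff p_def field_simps)
      finally show ?thesis .
    qed
  qed
  from this[of UNIV] show ?thesis by auto
qed

lemma filippov_regularization_vec_sgn:
  fixes A :: "real^'n^'n"
  shows "filippov_regularization (\<lambda>y. A *v vec_sgn y) x = (\<lambda>v. A *v v) ` sgn_set x"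
proof (rule antisym)
  let ?F = "(\<lambda>v. A *v v) ` sgn_set x"
  have "convex ?F"
    by (simp add: sgn_set_cbox convex_linear_image)
  have "closed ?F"
    unfolding sgn_set_cbox
    by (intro compact_imp_closed compact_continuous_image
          matrix_vector_mult_linear_continuous_on compact_cbox)
  obtain d where d: "d > 0" "\<And>y. y \<in> ball x d \<Longrightarrow> vec_sgn y \<in> sgn_set x"
    using eventually_vec_sgn_in_sgn_set[of x]
    by (auto simp: eventually_nhds_metric dist_commute)
  have "closure (convex hull ((\<lambda>y. A *v vec_sgn y) ` (ball x d - {}))) \<subseteq> ?F"
    using d(2) \<open>convex ?F\<close> \<open>closed ?F\<close> by (intro closure_minimal hull_minimal) auto
  moreover have "filippov_regularization (\<lambda>y. A *v vec_sgn y) x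
      \<subseteq> closure (convex hull ((\<lambda>y. A *v vec_sgn y) ` (ball x d - {})))"
    unfolding filippov_regularization_def using d(1) negligible_empty by blast
  ultimately show "filippov_regularization (\<lambda>y. A *v vec_sgn y) x \<subseteq> ?F"
    by blast
  show "?F \<subseteq> filippov_regularization (\<lambda>y. A *v vec_sgn y) x"
    unfolding filippov_regularization_def
  proof (intro INT_greatest)
    fix d :: real and N :: "(real^'n) set"
    assume dN: "d \<in> {0<..}" "N \<in> {N. negligible N}"
    let ?C = "convex hull ((\<lambda>y. A *v vec_sgn y) ` (ball x d - N))"
    have "sgn_set x \<subseteq> (\<lambda>v. A *v v) -` ?C"
    proof (rule sgn_set_subset_convex)
      show "convex ((\<lambda>v. A *v v) -` ?C)"
        by (intro convex_linear_vimage matrix_vector_mul_linear convex_convex_hull)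
      fix w assume "w \<in> sgn_set x" "\<And>i. \<bar>w $ i\<bar> = 1"
      then have "w \<in> vec_sgn ` (ball x d - N)"
        using dN by (intro vertex_in_image) auto
      then show "w \<in> (\<lambda>v. A *v v) -` ?C"
        by (auto intro!: hull_inc)
    qed
    then show "?F \<subseteq> closure ?C"
      using closure_subset by blast
  qed
qed

end

theory Submission
  imports Defs
begin

text \<open>
  Everything comes from the nonsmooth Lyapunov function
  \<open>V(\<sigma>) = \<Sum>i. \<bar>\<sigma>\<^sub>i\<bar> / X\<^sub>i\<^sub>i\<close>. The lower right block of the matrix inequality makes the
  diagonal of \<open>X\<close> positive, so \<open>V\<close> is a norm. Along a Filippov solution the velocity is
  \<open>B Z X\<inverse> v\<close> for some selection \<open>v\<close> of the set-valued sign of \<open>\<sigma>\<close>, and \<open>v\<close> is also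
  a subgradient of the \<open>l\<^sub>1\<close> norm at \<open>\<sigma>\<close>. With \<open>x = X\<inverse> v\<close>, which uses that \<open>X\<close> is diagonal
  and hence symmetric, \<open>V\<close> changes at the rate \<open>v \<bullet> (X\<inverse> B Z X\<inverse> v) = x \<bullet> (B Z x)\<close>. The upper left
  block at the vertices says that \<open>2 (x \<bullet> (B\<^sub>i Z x)) < - (x \<bullet> (R x))\<close> for \<open>x \<noteq> 0\<close>, and negativity of
  \<open>x \<bullet> (B Z x)\<close> is a convex condition on \<open>B\<close>, so it holds on the convex hull. Hence \<open>V\<close> never
  increases. As long as \<open>\<sigma> \<noteq> 0\<close>, some component of \<open>v\<close> is \<open>1\<close> or \<open>- 1\<close>, so \<open>v\<close> stays away
  from \<open>0\<close> and \<open>V\<close> decreases at least at a fixed rate \<open>c > 0\<close>. Every solution therefore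
  reaches the origin in finite time and remains there.

  Two analytic points make this rigorous. First, \<open>V \<circ> \<sigma>\<close> is absolutely continuous, and a bound on
  its derivative almost everywhere has to be integrated: this is
  \<open>absolutely_continuous_growth_bound\<close>. Second, the chain rule for \<open>\<bar>\<sigma>\<^sub>i\<bar>\<close> fails where
  \<open>\<sigma>\<^sub>i\<close> crosses zero with nonzero speed; such times are isolated, hence countably
  many: this is \<open>countable_transversal_zeros\<close>. Both enter \<open>filippov_sgn_weighted_l1_growth\<close>.
\<close>

section \<open>Differential inequalities for absolutely continuous functions\<close>

text \<open>The cells of a division overlap only in their frontiers, so their lengths add up to the
  measure of their union.\<close>

lemma real_division_lengths_le_measure:
  fixes D :: "real set set"
  assumes D: "D division_of T" and "T \<subseteq> U" "U \<in> lmeasurable"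
  shows "(\<Sum>k\<in>D. Sup k - Inf k) \<le> measure lebesgue U"
proof -
  have int: "\<exists>a b. k = {a..b} \<and> a \<le> b" if "k \<in> D" for k
    using division_ofD(3,4)[OF D that] by force
  have "(\<Sum>k\<in>D. Sup k - Inf k) = (\<Sum>k\<in>D. measure lebesgue k)"
  proof (rule sum.cong)
    fix k assume "k \<in> D"
    then obtain a b where "k = {a..b}" "a \<le> b" using int by blast
    then show "Sup k - Inf k = measure lebesgue k" by simp
  qed simp
  also have "\<dots> = measure lebesgue (\<Union>D)"
  proof (rule measure_negligible_finite_Union[symmetric])
    show "finite D" using D by blast
    show "k \<in> lmeasurable" if "k \<in> D" for k
    proof -
      obtain a b where "k = cbox a b" using int[OF \<open>k \<in> D\<close>] by auto
      then show ?thesis by simp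
    qed
    show "pairwise (\<lambda>S T. negligible (S \<inter> T)) D"
    proof (rule pairwiseI)
      fix j k assume jk: "j \<in> D" "k \<in> D" "j \<noteq> k"
      obtain a b where ab: "j = cbox a b" using division_ofD(4)[OF D jk(1)] by blast
      obtain c d where cd: "k = cbox c d" using division_ofD(4)[OF D jk(2)] by blast
      have "box a b \<inter> box c d = {}"
        using division_ofD(5)[OF D jk] ab cd by simp
      then have "j \<inter> k \<subseteq> (cbox a b - box a b) \<union> (cbox c d - box c d)"
        using ab cd by blast
      then show "negligible (j \<inter> k)"
        by (meson negligible_Un negligible_frontier_interval negligible_subset)
    qed
  qed
  also have "\<dots> \<le> measure lebesgue U"
    using D assms(2,3) 
    by (intro measure_mono_fmeasurable) (auto simp: division_ofD(6)[OF D] intro: lmeasurable_division fmeasurableD)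
  finally show ?thesis .
qed

lemma absolutely_continuous_onE:
  assumes "absolutely_continuous_on S f" "e > 0"
  obtains \<delta> where "\<delta> > 0" "\<And>D T. \<lbrakk>D division_of T; T \<subseteq> S; (\<Sum>k\<in>D. Sup k - Inf k) < \<delta>\<rbrakk> \<Longrightarrow>
          (\<Sum>k\<in>D. norm (f (Sup k) - f (Inf k))) < e"
proof -
  obtain \<delta> where \<delta>: "\<delta> > 0"
      "\<forall>D T. D division_of T \<and> T \<subseteq> S \<and> (\<Sum>k\<in>D. Sup k - Inf k) < \<delta> \<longrightarrow>
        (\<Sum>k\<in>D. norm (f (Sup k) - f (Inf k))) < e"
    using assms(1)[unfolded absolutely_continuous_on_def, THEN spec, THEN mp, OF assms(2)] by (elim exE conjE)
  show thesis
    by (rule that[OF \<delta>(1)], rule \<delta>(2)[THEN spec, THEN spec, THEN mp], intro conjI)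
qed

lemma absolutely_continuous_on_subset:
  assumes ac: "absolutely_continuous_on S f" and "T \<subseteq> S"
  shows "absolutely_continuous_on T f"
  unfolding absolutely_continuous_on_def
proof (intro allI impI)
  fix e :: real assume "e > 0"
  obtain \<delta> where "\<delta> > 0" and \<delta>:
      "\<And>D T. \<lbrakk>D division_of T; T \<subseteq> S; (\<Sum>k\<in>D. Sup k - Inf k) < \<delta>\<rbrakk> \<Longrightarrow>
          (\<Sum>k\<in>D. norm (f (Sup k) - f (Inf k))) < e"
    using absolutely_continuous_onE[OF ac \<open>e > 0\<close>] by metis
  show "\<exists>\<delta>>0. \<forall>D T'. D division_of T' \<and> T' \<subseteq> T \<and> (\<Sum>k\<in>D. Sup k - Inf k) < \<delta> \<longrightarrow>
        (\<Sum>k\<in>D. norm (f (Sup k) - f (Inf k))) < e"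
  proof (intro exI[of _ \<delta>] conjI allI impI \<open>\<delta> > 0\<close>, elim conjE)
    fix D T' assume "D division_of T'" "T' \<subseteq> T" "(\<Sum>k\<in>D. Sup k - Inf k) < \<delta>"
    then show "(\<Sum>k\<in>D. norm (f (Sup k) - f (Inf k))) < e"
      using \<delta>[of D T'] \<open>T \<subseteq> S\<close> by simp
  qed
qed

text \<open>
  A derivative bound off a null set integrates to a bound on the increment. Cover the null set
  \<open>E\<close> by an open set \<open>U\<close> of small measure and choose a gauge that keeps the cells tagged in \<open>E\<close> inside
  \<open>U\<close>, and every other cell so short that the increment over it is at most \<open>m + e\<close> times its length.
  By Cousin's lemma a division fine for this gauge exists. Absolute continuity makes the total
  increment over the cells tagged in \<open>E\<close> small, and the derivative bound controls the other cells.
\<close>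

lemma absolutely_continuous_growth_bound:
  fixes g :: "real \<Rightarrow> real"
  assumes ac: "absolutely_continuous_on {a..b} g" and "a \<le> b" and "negligible E"
    and der: "\<And>t. t \<in> {a..b} - E \<Longrightarrow>
                \<exists>d\<le>m. (g has_real_derivative d) (at t within {a..b})"
  shows "g b - g a \<le> m * (b - a)"
proof -
  have bound: "g b - g a - m * (b - a) \<le> e * (1 + \<bar>m\<bar> + (b - a))" if "e > 0" for e
  proof -
    obtain \<delta> where "\<delta> > 0" and \<delta>:
      "\<And>D T. \<lbrakk>D division_of T; T \<subseteq> {a..b}; (\<Sum>k\<in>D. Sup k - Inf k) < \<delta>\<rbrakk> \<Longrightarrow>
          (\<Sum>k\<in>D. norm (g (Sup k) - g (Inf k))) < e"
      using absolutely_continuous_onE[OF ac \<open>e > 0\<close>] by metis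
    \<comment> \<open>The tags in \<open>E\<close> also cost \<open>\<bar>m\<bar>\<close> times their total length, so that length is kept below \<open>e\<close> too.\<close>
    define \<eta> where "\<eta> = min \<delta> e"
    have "\<eta> > 0" using \<open>\<delta> > 0\<close> \<open>e > 0\<close> by (simp add: \<eta>_def)
    obtain U where U: "open U" "E \<subseteq> U" "U \<in> lmeasurable" "measure lebesgue U < \<eta>"
    proof -
      obtain T where T: "open T" "E \<subseteq> T" "T - E \<in> lmeasurable" "emeasure lebesgue (T - E) < ennreal \<eta>"
        using sets_lebesgue_outer_open[OF negligible_imp_sets[OF \<open>negligible E\<close>] \<open>\<eta> > 0\<close>] by blast
      have neg: "negligible (sym_diff T (T - E))"
        by (rule negligible_subset[OF \<open>negligible E\<close>]) auto
      have "T \<in> lmeasurable" "measure lebesgue T = measure lebesgue (T - E)"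
        using lmeasurable_negligible_symdiff[OF T(3)] measure_negligible_symdiff[of "T - E" T] T(3) neg
        by (auto simp: Un_commute)
      moreover have "measure lebesgue (T - E) < \<eta>"
        using T(3,4) \<open>\<eta> > 0\<close> by (simp add: emeasure_eq_measure2 ennreal_less_iff)
      ultimately show thesis using that T by simp
    qed
    \<comment> \<open>Straddle form of the derivative: the tag \<open>t\<close> lies between the endpoints \<open>u\<close> and \<open>v\<close>.\<close>
    have "\<exists>r>0. \<forall>u v. u \<in> {a..b} \<and> v \<in> {a..b} \<and> u \<le> t \<and> t \<le> v \<and> u \<in> ball t r \<and> v \<in> ball t r \<longrightarrow>
            g v - g u \<le> (m + e) * (v - u)" if t: "t \<in> {a..b} - E" for t
    proof -
      obtain d where "d \<le> m" and d: "(g has_real_derivative d) (at t within {a..b})"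
        using der[OF t] by blast
      obtain r where "r > 0" and r:
        "\<And>y. \<lbrakk>y \<in> {a..b}; \<bar>y - t\<bar> < r\<rbrakk> \<Longrightarrow> \<bar>g y - g t - d * (y - t)\<bar> \<le> e * \<bar>y - t\<bar>"
        using d \<open>e > 0\<close> unfolding has_field_derivative_def has_derivative_within_alt real_norm_def
        by blast
      have "g v - g u \<le> (m + e) * (v - u)"
        if "u \<in> {a..b}" "v \<in> {a..b}" "u \<le> t" "t \<le> v" "u \<in> ball t r" "v \<in> ball t r" for u v
      proof -
        have "\<bar>g v - g t - d * (v - t)\<bar> \<le> e * \<bar>v - t\<bar>" "\<bar>g u - g t - d * (u - t)\<bar> \<le> e * \<bar>u - t\<bar>"
          using that by (auto intro!: r simp: dist_real_def simp del: abs_of_nonneg abs_of_nonpos)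
        then have "g v - g u \<le> d * (v - u) + e * (v - u)"
          using that by (simp add: abs_le_iff algebra_simps)
        also have "\<dots> \<le> (m + e) * (v - u)"
          using \<open>d \<le> m\<close> that mult_right_mono[of d m "v - u"] by (simp add: algebra_simps)
        finally show ?thesis .
      qed
      then show ?thesis using \<open>r > 0\<close> by blast
    qed
    then obtain \<rho> where \<rho>: "\<And>t. t \<in> {a..b} - E \<Longrightarrow> \<rho> t > 0"
      "\<And>t u v. \<lbrakk>t \<in> {a..b} - E; u \<in> {a..b}; v \<in> {a..b}; u \<le> t; t \<le> v; u \<in> ball t (\<rho> t); v \<in> ball t (\<rho> t)\<rbrakk>
            \<Longrightarrow> g v - g u \<le> (m + e) * (v - u)"
      by metis
    define \<gamma> where "\<gamma> t = (if t \<in> E then U else if t \<in> {a..b} then ball t (\<rho> t) else UNIV)" for t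
    have "gauge \<gamma>"
      using U \<rho>(1) by (auto simp: gauge_def \<gamma>_def)
    then obtain p where p: "p tagged_division_of {a..b}" "\<gamma> fine p"
      using fine_division_exists_real by blast
    have tags: "\<exists>u v. K = {u..v} \<and> u \<le> x \<and> x \<le> v \<and> u \<in> {a..b} \<and> v \<in> {a..b} \<and> {u..v} \<subseteq> \<gamma> x \<and> x \<in> {a..b}"
      if xK: "(x, K) \<in> p" for x K
    proof -
      obtain u v where K: "K = {u..v}" using tagged_division_ofD(4)[OF p(1) xK] unfolding cbox_interval by blast
      have "x \<in> K" "K \<subseteq> {a..b}" "K \<subseteq> \<gamma> x"
        using tagged_division_ofD(2,3)[OF p(1) xK] p(2) xK by (auto simp: fine_def)
      then show ?thesis using K by (intro exI[of _ u] exI[of _ v]) auto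
    qed
    define p1 where "p1 = {(x, K) \<in> p. x \<in> E}"
    define len where "len K = Sup K - Inf K" for K :: "real set"
    define inc where "inc K = g (Sup K) - g (Inf K)" for K
    have "p1 \<subseteq> p" "finite p" using p(1) by (auto simp: p1_def)
    have tp1: "p1 tagged_partial_division_of {a..b}"
      using p(1) \<open>p1 \<subseteq> p\<close> by (meson tagged_division_of_def tagged_partial_division_subset)
    let ?D = "snd ` p1" let ?T = "\<Union>(snd ` p1)"
    have D: "?D division_of ?T" by (rule partial_division_of_tagged_division[OF tp1])
    have "?T \<subseteq> {a..b}" "?T \<subseteq> U"
      using tags by (fastforce simp: p1_def \<gamma>_def)+
    \<comment> \<open>Only degenerate cells can carry several tags, so a sum over tagged cells is a sum over cells.\<close>
    have onD: "(\<Sum>(x,K)\<in>p1. h K) = (\<Sum>K\<in>?D. h K)" if h0: "\<And>u. h {u..u} = 0" for h :: "real set \<Rightarrow> real"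
    proof -
      \<comment> \<open>The empty set counts as a degenerate box, where the infimum and supremum carry no information.\<close>
      define h' where "h' K = (if K = {} then 0 else h K)" for K
      have ne: "K \<noteq> {}" if "(x, K) \<in> p1" for x K
      proof -
        have "(x, K) \<in> p" using that \<open>p1 \<subseteq> p\<close> by blast
        from tags[OF this] show ?thesis by auto
      qed
      have "h' (cbox u v) = 0" if "box u v = {}" for u v
      proof (cases "cbox u v = {}")
        case False
        then have "u \<le> v" by simp
        moreover have "v \<le> u" using that by simp
        ultimately have "v = u" by simp
        show ?thesis unfolding \<open>v = u\<close> h'_def using h0[of u] by simp
      qed (simp add: h'_def)
      then have "(\<Sum>(x,K)\<in>p1. h' K) = (\<Sum>K\<in>?D. h' K)"
        by (rule sum.over_tagged_division_lemma[OF tagged_partial_division_of_Union_self[OF tp1]])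
      moreover have "(\<Sum>(x,K)\<in>p1. h' K) = (\<Sum>(x,K)\<in>p1. h K)"
        using ne by (intro sum.cong) (auto simp: h'_def)
      moreover have "(\<Sum>K\<in>?D. h' K) = (\<Sum>K\<in>?D. h K)"
        using ne by (intro sum.cong) (auto simp: h'_def)
      ultimately show ?thesis by simp
    qed
    have len1: "(\<Sum>K\<in>?D. len K) < \<eta>"
      using real_division_lengths_le_measure[OF D \<open>?T \<subseteq> U\<close> U(3)] U(4) by (simp add: len_def)
    then have inc1: "(\<Sum>K\<in>?D. \<bar>inc K\<bar>) < e"
      using \<delta>[OF D \<open>?T \<subseteq> {a..b}\<close>] by (simp add: len_def inc_def \<eta>_def)
    have tel: "(\<Sum>(x,K)\<in>p. inc K) = g b - g a" "(\<Sum>(x,K)\<in>p. len K) = b - a"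
      using additive_tagged_division_1[OF \<open>a \<le> b\<close> p(1), of g]
        additive_tagged_division_1[OF \<open>a \<le> b\<close> p(1), of "\<lambda>x. x"]
      by (simp_all add: inc_def len_def)
    have "g b - g a - m * (b - a) = (\<Sum>(x,K)\<in>p. inc K - m * len K)"
      unfolding tel[symmetric] by (simp add: sum_subtractf sum_distrib_left case_prod_unfold)
    also have "\<dots> \<le> (\<Sum>(x,K)\<in>p. e * len K + (if x \<in> E then \<bar>inc K\<bar> + \<bar>m\<bar> * len K else 0))"
    proof (rule sum_mono, clarsimp, intro conjI impI)
      fix x K assume xK: "(x, K) \<in> p"
      obtain u v where uv: "K = {u..v}" "u \<le> x" "x \<le> v" "u \<in> {a..b}" "v \<in> {a..b}" "{u..v} \<subseteq> \<gamma> x" "x \<in> {a..b}"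
        using tags[OF xK] by blast
      have K: "len K = v - u" "inc K = g v - g u" "u \<le> v"
        using uv by (auto simp: len_def inc_def)
      { assume "x \<in> E"
        have "- (m * len K) \<le> \<bar>m\<bar> * len K" "0 \<le> e * len K"
          using K \<open>e > 0\<close> mult_right_mono[of "-m" "\<bar>m\<bar>" "len K"] by auto
        then show "inc K - m * len K \<le> e * len K + (\<bar>inc K\<bar> + \<bar>m\<bar> * len K)" by linarith }
      { assume "x \<notin> E"
        then have "{u..v} \<subseteq> ball x (\<rho> x)" using uv by (auto simp: \<gamma>_def)
        then have "u \<in> ball x (\<rho> x)" "v \<in> ball x (\<rho> x)" using \<open>u \<le> v\<close> by auto
        then have "g v - g u \<le> (m + e) * (v - u)"
          using \<rho>(2)[of x u v] uv \<open>x \<notin> E\<close> by blast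
        then show "inc K - m * len K \<le> e * len K" unfolding K(1,2) by (simp add: algebra_simps) }
    qed
    also have "\<dots> = e * (b - a) + (\<Sum>(x,K)\<in>p. if x \<in> E then \<bar>inc K\<bar> + \<bar>m\<bar> * len K else 0)"
      unfolding tel[symmetric] by (simp add: sum.distrib sum_distrib_left case_prod_unfold)
    also have "(\<Sum>(x,K)\<in>p. if x \<in> E then \<bar>inc K\<bar> + \<bar>m\<bar> * len K else 0) = (\<Sum>(x,K)\<in>p1. \<bar>inc K\<bar> + \<bar>m\<bar> * len K)"
      unfolding p1_def case_prod_unfold
      by (subst sum.inter_filter[OF \<open>finite p\<close>, symmetric]) (simp add: case_prod_unfold)
    also have "\<dots> = (\<Sum>K\<in>?D. \<bar>inc K\<bar>) + \<bar>m\<bar> * (\<Sum>K\<in>?D. len K)"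
      by (subst onD) (simp_all add: inc_def len_def sum.distrib sum_distrib_left)
    also have "\<dots> \<le> e + \<bar>m\<bar> * e"
      using inc1 len1 by (intro add_mono mult_left_mono) (auto simp: \<eta>_def)
    finally show ?thesis by (simp add: algebra_simps)
  qed
  define C where "C = 1 + \<bar>m\<bar> + (b - a)"
  have "C > 0" using \<open>a \<le> b\<close> by (simp add: C_def)
  have "g b - g a - m * (b - a) \<le> 0"
  proof (rule field_le_epsilon)
    fix e :: real assume "e > 0"
    then show "g b - g a - m * (b - a) \<le> 0 + e"
      using bound[of "e / C"] \<open>C > 0\<close> by (simp flip: C_def)
  qed
  then show ?thesis by simp
qed

lemma absolutely_continuous_on_lipschitz_compose:
  assumes ac: "absolutely_continuous_on S f" and "L > 0"
    and lip: "\<And>x y. norm (h x - h y) \<le> L * norm (x - y)"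
  shows "absolutely_continuous_on S (\<lambda>t. h (f t))"
  unfolding absolutely_continuous_on_def
proof (intro allI impI)
  fix e :: real assume "e > 0"
  then have "e / L > 0" using \<open>L > 0\<close> by simp
  obtain \<delta> where "\<delta> > 0" and \<delta>:
      "\<And>D T. \<lbrakk>D division_of T; T \<subseteq> S; (\<Sum>k\<in>D. Sup k - Inf k) < \<delta>\<rbrakk> \<Longrightarrow>
          (\<Sum>k\<in>D. norm (f (Sup k) - f (Inf k))) < e / L"
    using absolutely_continuous_onE[OF ac \<open>e / L > 0\<close>] by metis
  show "\<exists>\<delta>>0. \<forall>D T. D division_of T \<and> T \<subseteq> S \<and> (\<Sum>k\<in>D. Sup k - Inf k) < \<delta> \<longrightarrow>
        (\<Sum>k\<in>D. norm (h (f (Sup k)) - h (f (Inf k)))) < e"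
  proof (intro exI[of _ \<delta>] conjI allI impI \<open>\<delta> > 0\<close>, elim conjE)
    fix D T assume "D division_of T" "T \<subseteq> S" "(\<Sum>k\<in>D. Sup k - Inf k) < \<delta>"
    then have "L * (\<Sum>k\<in>D. norm (f (Sup k) - f (Inf k))) < e"
      using \<delta> \<open>L > 0\<close> by (simp add: field_simps)
    moreover have "(\<Sum>k\<in>D. norm (h (f (Sup k)) - h (f (Inf k))))
        \<le> L * (\<Sum>k\<in>D. norm (f (Sup k) - f (Inf k)))"
      unfolding sum_distrib_left by (intro sum_mono lip)
    ultimately show "(\<Sum>k\<in>D. norm (h (f (Sup k)) - h (f (Inf k)))) < e" by linarith
  qed
qed

text \<open>Near a zero \<open>t\<close> with nonzero derivative the difference quotient stays nonzero, so \<open>f\<close> has no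
  other zero there. Such zeros form a discrete set, and discrete subsets of the line are countable.\<close>

lemma countable_transversal_zeros:
  fixes f :: "real \<Rightarrow> real"
  shows "countable {t \<in> T. f t = 0 \<and> (\<exists>d. d \<noteq> 0 \<and> (f has_real_derivative d) (at t within T))}"
    (is "countable ?S")
proof -
  have "?S sparse_in ?S"
    unfolding sparse_in_def
  proof
    fix t assume "t \<in> ?S"
    then obtain d where t: "t \<in> T" "f t = 0" "d \<noteq> 0" "(f has_real_derivative d) (at t within T)"
      by blast
    have "\<forall>\<^sub>F y in at t within T. (f y - f t) / (y - t) \<noteq> 0"
      using t(3,4) by (intro tendsto_imp_eventually_ne) (auto simp: has_field_derivative_iff)
    then obtain V where V: "open V" "t \<in> V" "\<And>y. \<lbrakk>y \<in> V; y \<noteq> t; y \<in> T\<rbrakk> \<Longrightarrow> f y \<noteq> 0"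
      using t(2) unfolding eventually_at_topological by auto
    have sep: "y = t" if "y \<in> ?S" "y \<in> V" for y
      using V(3)[of y] that by auto
    have "\<not> y islimpt ?S" if "y \<in> V" for y
    proof
      assume y: "y islimpt ?S"
      show False
      proof (cases "y = t")
        case True
        obtain z where z: "z \<in> ?S" "z \<in> V" "z \<noteq> y"
          by (rule islimptE[OF y \<open>y \<in> V\<close> \<open>open V\<close>])
        from sep[OF z(1,2)] z(3) True show False by simp
      next
        case False
        have "open (V - {t})" using V(1) by auto
        have "y \<in> V - {t}" using False \<open>y \<in> V\<close> by blast
        obtain z where z: "z \<in> ?S" "z \<in> V - {t}"
          by (rule islimptE[OF y \<open>y \<in> V - {t}\<close> \<open>open (V - {t})\<close>])
        from sep[OF z(1)] z(2) show False by simp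
      qed
    qed
    with V(1,2) show "\<exists>V. t \<in> V \<and> open V \<and> (\<forall>y\<in>V. \<not> y islimpt ?S)" by blast
  qed
  then obtain D where D: "open D" "?S \<subseteq> D" "\<forall>y\<in>D. \<not> y islimpt ?S"
    by (rule get_sparse_in_cover)
  then have "countable (D \<inter> ?S)"
    by (intro sparse_imp_countable) (auto simp: sparse_in_open)
  with D(2) show ?thesis by (simp add: Int_absorb1)
qed

text \<open>At a zero with vanishing derivative \<open>\<bar>f\<bar>\<close> is differentiable as well, with derivative \<open>0\<close>;
  hence any value \<open>v\<close> may be used there. This freedom lets \<open>v\<close> be the component of the
  selection that drives the Filippov solution.\<close>

lemma has_real_derivative_abs_sgn_selection:
  fixes f :: "real \<Rightarrow> real"
  assumes f: "(f has_real_derivative d) (at t within T)"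
    and v: "f t \<noteq> 0 \<Longrightarrow> v = sgn (f t)" and kink: "f t = 0 \<Longrightarrow> d = 0"
  shows "((\<lambda>s. \<bar>f s\<bar>) has_real_derivative v * d) (at t within T)"
proof (cases "f t = 0")
  case False
  have "(abs has_real_derivative sgn (f t)) (at (f t))"
    using GDERIV_norm[OF False]
    by (simp add: gderiv_def has_field_derivative_def mult_commute_abs[of "sgn (f t)"] real_norm_def[abs_def])
  then have "((\<lambda>s. \<bar>f s\<bar>) has_real_derivative sgn (f t) * d) (at t within T)"
    by (rule DERIV_chain'[OF f])
  then show ?thesis using v[OF False] by simp
next
  case True
  have "((\<lambda>y. (f y - f t) / (y - t)) \<longlongrightarrow> 0) (at t within T)"
    using f kink[OF True] by (simp add: has_field_derivative_iff)
  then have "((\<lambda>y. \<bar>(f y - f t) / (y - t)\<bar>) \<longlongrightarrow> 0) (at t within T)"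
    by (rule tendsto_rabs_zero)
  then have "((\<lambda>y. (\<bar>f y\<bar> - \<bar>f t\<bar>) / (y - t)) \<longlongrightarrow> 0) (at t within T)"
    by (rule Lim_null_comparison[rotated]) (simp add: True abs_divide)
  then show ?thesis using kink[OF True] by (simp add: has_field_derivative_iff)
qed

section \<open>Relay feedback with a diagonally stable matrix\<close>

definition weighted_l1 :: "('n::finite \<Rightarrow> real) \<Rightarrow> real^'n \<Rightarrow> real" where
  "weighted_l1 p x = (\<Sum>i\<in>UNIV. p i * \<bar>x $ i\<bar>)"

lemma weighted_l1_nonneg:
  assumes "\<And>i. p i > 0"
  shows "0 \<le> weighted_l1 p x"
  unfolding weighted_l1_def using assms by (intro sum_nonneg) (simp add: less_imp_le)

lemma weighted_l1_le_norm: "\<bar>weighted_l1 p x - weighted_l1 p y\<bar> \<le> (\<Sum>i\<in>UNIV. \<bar>p i\<bar>) * norm (x - y)"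
proof -
  have "\<bar>weighted_l1 p x - weighted_l1 p y\<bar> = \<bar>\<Sum>i\<in>UNIV. p i * (\<bar>x $ i\<bar> - \<bar>y $ i\<bar>)\<bar>"
    by (simp add: weighted_l1_def sum_subtractf algebra_simps)
  also have "\<dots> \<le> (\<Sum>i\<in>UNIV. \<bar>p i\<bar> * norm (x - y))"
  proof (rule order_trans[OF sum_abs], rule sum_mono)
    fix i
    have "\<bar>\<bar>x $ i\<bar> - \<bar>y $ i\<bar>\<bar> \<le> norm (x - y)"
      using component_le_norm_cart[of "x - y" i] by simp
    then show "\<bar>p i * (\<bar>x $ i\<bar> - \<bar>y $ i\<bar>)\<bar> \<le> \<bar>p i\<bar> * norm (x - y)"
      by (simp add: abs_mult mult_left_mono)
  qed
  finally show ?thesis by (simp add: sum_distrib_right)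
qed

lemma weighted_l1_ge_norm:
  assumes "q \<ge> 0" "\<And>i. p i \<ge> q"
  shows "q * norm x \<le> weighted_l1 p x"
proof -
  have "q * norm x \<le> q * (\<Sum>i\<in>UNIV. \<bar>x $ i\<bar>)"
    using assms(1) norm_le_l1_cart by (intro mult_left_mono) auto
  also have "\<dots> \<le> weighted_l1 p x"
    unfolding weighted_l1_def sum_distrib_left using assms(2) by (intro sum_mono mult_right_mono) auto
  finally show ?thesis .
qed

text \<open>
  Along a Filippov solution the weighted \<open>l\<^sub>1\<close> norm has derivative \<open>\<Sum>i. p\<^sub>i v\<^sub>i (A v)\<^sub>i\<close> at almost
  every time, with the same selection \<open>v\<close> of the set-valued sign as in the velocity \<open>A v\<close>. The times
  left out are those at which the inclusion fails and those at which a component of the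
  solution has a transversal zero.
\<close>

lemma filippov_sgn_weighted_l1_growth:
  fixes A :: "real^'n^'n"
  assumes sol: "filippov_solution (\<lambda>y. A *v vec_sgn y) \<sigma>" and ab: "0 \<le> a" "a \<le> b"
    and m: "\<And>t v. \<lbrakk>t \<in> {a..b}; v \<in> sgn_set (\<sigma> t)\<rbrakk> \<Longrightarrow>
              (\<Sum>i\<in>UNIV. p i * (v $ i * (A *v v) $ i)) \<le> m"
  shows "weighted_l1 p (\<sigma> b) - weighted_l1 p (\<sigma> a) \<le> m * (b - a)"
proof -
  have incl: "inclusion_solution (\<lambda>x. (\<lambda>v. A *v v) ` sgn_set x) \<sigma>"
    using sol by (simp add: filippov_solution_def filippov_regularization_vec_sgn[abs_def])
  have "absolutely_continuous_on {0..b+1} \<sigma>"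
    using incl ab by (simp add: inclusion_solution_def)
  then have "absolutely_continuous_on {a..b} \<sigma>"
    by (rule absolutely_continuous_on_subset) (use ab in auto)
  then have ac: "absolutely_continuous_on {a..b} (\<lambda>t. weighted_l1 p (\<sigma> t))"
  proof (rule absolutely_continuous_on_lipschitz_compose)
    show "0 < (\<Sum>i\<in>UNIV. \<bar>p i\<bar>) + 1" by (simp add: add_nonneg_pos sum_nonneg)
    show "norm (weighted_l1 p x - weighted_l1 p y) \<le> ((\<Sum>i\<in>UNIV. \<bar>p i\<bar>) + 1) * norm (x - y)" for x y
      using weighted_l1_le_norm[of p x y] by (simp add: algebra_simps add_increasing)
  qed
  have "AE t in lebesgue. t \<ge> 0 \<longrightarrow>
      (\<exists>v\<in>sgn_set (\<sigma> t). (\<sigma> has_vector_derivative A *v v) (at t within {0..}))"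
    using incl by (simp add: inclusion_solution_def)
  then obtain E0 where "E0 \<in> null_sets lebesgue" and
    E0: "\<And>t. \<lbrakk>t \<notin> E0; t \<ge> 0\<rbrakk> \<Longrightarrow>
      \<exists>v\<in>sgn_set (\<sigma> t). (\<sigma> has_vector_derivative A *v v) (at t within {0..})"
    by (elim AE_E3) force
  define E1 where "E1 i = {t \<in> {0..}. \<sigma> t $ i = 0 \<and>
      (\<exists>d. d \<noteq> 0 \<and> ((\<lambda>s. \<sigma> s $ i) has_real_derivative d) (at t within {0..}))}" for i
  have "countable (\<Union>i. E1 i)"
    unfolding E1_def by (intro countable_UN countable_transversal_zeros) auto
  then have negl: "negligible (E0 \<union> (\<Union>i. E1 i))"
    using \<open>E0 \<in> null_sets lebesgue\<close>
    by (intro negligible_Un) (auto simp: negligible_iff_null_sets intro: null_sets_completionI countable_imp_null_set_lborel)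
  show ?thesis
  proof (rule absolutely_continuous_growth_bound[OF ac \<open>a \<le> b\<close> negl])
    fix t assume t: "t \<in> {a..b} - (E0 \<union> (\<Union>i. E1 i))"
    then have "t \<ge> 0" using ab by auto
    then obtain v where v: "v \<in> sgn_set (\<sigma> t)"
      and dv: "(\<sigma> has_vector_derivative A *v v) (at t within {0..})"
      using E0 t by blast
    have "((\<lambda>s. \<bar>\<sigma> s $ i\<bar>) has_real_derivative v $ i * (A *v v) $ i) (at t within {0..})" for i
    proof (rule has_real_derivative_abs_sgn_selection)
      show *: "((\<lambda>s. \<sigma> s $ i) has_real_derivative (A *v v) $ i) (at t within {0..})"
        using bounded_linear.has_vector_derivative[OF bounded_linear_vec_nth dv]
        by (simp add: has_real_derivative_iff_has_vector_derivative)
      show "v $ i = sgn (\<sigma> t $ i)" if "\<sigma> t $ i \<noteq> 0"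
        using v that by (simp add: sgn_set_def)
      show "(A *v v) $ i = 0" if "\<sigma> t $ i = 0"
        using * that t \<open>t \<ge> 0\<close> by (auto simp: E1_def)
    qed
    then have "((\<lambda>s. weighted_l1 p (\<sigma> s)) has_real_derivative
        (\<Sum>i\<in>UNIV. p i * (v $ i * (A *v v) $ i))) (at t within {0..})"
      unfolding weighted_l1_def by (intro DERIV_sum DERIV_cmult)
    moreover have "{a..b} \<subseteq> {0..}" using ab by auto
    ultimately show "\<exists>d\<le>m. ((\<lambda>s. weighted_l1 p (\<sigma> s)) has_real_derivative d) (at t within {a..b})"
      using m[OF _ v] t by (meson DERIV_subset DiffD1)
  qed
qed

text \<open>The form attains its maximum on the compact unit sphere, and homogeneity extends the bound.\<close>

lemma negative_quadratic_form_uniform: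
  fixes f :: "'a::euclidean_space \<Rightarrow> 'a"
  assumes "linear f" and neg: "\<And>v. v \<noteq> 0 \<Longrightarrow> v \<bullet> f v < 0"
  obtains c where "c > 0" "\<And>v. v \<bullet> f v \<le> - c * (norm v)\<^sup>2"
proof -
  have "continuous_on (sphere 0 1) (\<lambda>v. v \<bullet> f v)"
    using assms(1) by (intro continuous_intros linear_continuous_on linear_conv_bounded_linear[THEN iffD1])
  moreover have "(sphere 0 1 :: 'a set) \<noteq> {}" by simp
  ultimately obtain w where w: "w \<in> sphere 0 1" "\<And>v. v \<in> sphere 0 1 \<Longrightarrow> v \<bullet> f v \<le> w \<bullet> f w"
    using continuous_attains_sup[OF compact_sphere] by blast
  show thesis
  proof
    show "- (w \<bullet> f w) > 0" using neg[of w] w(1) by fastforce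
    fix v :: 'a
    show "v \<bullet> f v \<le> - (- (w \<bullet> f w)) * (norm v)\<^sup>2"
    proof (cases "v = 0")
      case False
      have "sgn v \<bullet> f (sgn v) \<le> w \<bullet> f w"
        using False by (intro w(2)) (simp add: norm_sgn)
      then show ?thesis
        using False
        by (simp add: sgn_div_norm linear_cmul[OF \<open>linear f\<close>] field_simps power2_eq_square)
    qed simp
  qed
qed

lemma norm_sgn_set_ge_1:
  assumes "x \<noteq> 0" "v \<in> sgn_set x"
  shows "norm v \<ge> 1"
proof -
  obtain i where "x $ i \<noteq> 0" using assms(1) by (auto simp: vec_eq_iff)
  then have "\<bar>v $ i\<bar> = 1" using assms(2) by (auto simp: sgn_set_def sgn_if)
  then show ?thesis using component_le_norm_cart[of v i] by simp
qed

text \<open>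
  The hypothesis is diagonal stability of \<open>A\<close>: the diagonal matrix \<open>P\<close> with entries \<open>p\<^sub>i\<close> makes the
  quadratic form of \<open>P A\<close> negative definite. The form is at most \<open>- c\<close> on selections of the sign away from the origin, so
  a solution starting at \<open>\<sigma> 0\<close> reaches the origin no later than time \<open>V (\<sigma> 0) / c\<close>.
\<close>

theorem diagonally_stable_relay_globally_asymptotically_stable:
  fixes A :: "real^'n^'n" and p :: "'n \<Rightarrow> real"
  assumes p: "\<And>i. p i > 0"
    and neg: "\<And>v. v \<noteq> 0 \<Longrightarrow> (\<Sum>i\<in>UNIV. p i * (v $ i * (A *v v) $ i)) < 0"
  shows "globally_asymptotically_stable (\<lambda>y. A *v vec_sgn y)"
proof -
  define V where "V = weighted_l1 p"
  define q where "q = Min (range p)"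
  have "q > 0" "\<And>i. q \<le> p i" using p by (auto simp: q_def)
  then have lower: "q * norm x \<le> V x" for x
    unfolding V_def by (intro weighted_l1_ge_norm) auto
  have V0: "V 0 = 0" by (simp add: V_def weighted_l1_def)
  have Vnn: "V x \<ge> 0" for x unfolding V_def by (rule weighted_l1_nonneg[OF p])
  have form: "(\<Sum>i\<in>UNIV. p i * (v $ i * (A *v v) $ i)) = v \<bullet> (\<chi> i. p i * (A *v v) $ i)" for v
    by (simp add: inner_vec_def mult_ac)
  have "linear (\<lambda>v. \<chi> i. p i * (A *v v) $ i)"
    by (intro linearI) (simp_all add: vec_eq_iff matrix_vector_right_distrib
        matrix_vector_mult_scaleR distrib_left)
  then obtain c where "c > 0" and c: "\<And>v. (\<Sum>i\<in>UNIV. p i * (v $ i * (A *v v) $ i)) \<le> - c * (norm v)\<^sup>2"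
    using negative_quadratic_form_uniform neg unfolding form by blast
  have decr: "V (\<sigma> b) \<le> V (\<sigma> a)"
    if "filippov_solution (\<lambda>y. A *v vec_sgn y) \<sigma>" "0 \<le> a" "a \<le> b" for \<sigma> a b
  proof -
    have "(\<Sum>i\<in>UNIV. p i * (v $ i * (A *v v) $ i)) \<le> 0" for v
      using neg[of v] by (cases "v = 0") auto
    then show ?thesis
      using filippov_sgn_weighted_l1_growth[OF that, of p 0] by (simp add: V_def)
  qed
  have "lyapunov_stable (\<lambda>y. A *v vec_sgn y)"
    unfolding lyapunov_stable_def
  proof (intro allI impI)
    fix \<epsilon> :: real assume "\<epsilon> > 0"
    define L where "L = (\<Sum>i\<in>UNIV. \<bar>p i\<bar>) + 1"
    have "L > 0" by (simp add: L_def add_nonneg_pos sum_nonneg)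
    have upper: "V x \<le> L * norm x" for x
      using weighted_l1_le_norm[of p x 0] V0 by (simp add: V_def L_def algebra_simps add_increasing)
    show "\<exists>\<delta>>0. \<forall>\<sigma>. filippov_solution (\<lambda>y. A *v vec_sgn y) \<sigma> \<and> norm (\<sigma> 0) < \<delta> \<longrightarrow>
        (\<forall>t\<ge>0. norm (\<sigma> t) < \<epsilon>)"
    proof (intro exI[of _ "q * \<epsilon> / L"] conjI allI impI)
      show "q * \<epsilon> / L > 0" using \<open>q > 0\<close> \<open>\<epsilon> > 0\<close> \<open>L > 0\<close> by simp
      fix \<sigma> :: "real \<Rightarrow> real^'n" and t :: real
      assume \<sigma>: "filippov_solution (\<lambda>y. A *v vec_sgn y) \<sigma> \<and> norm (\<sigma> 0) < q * \<epsilon> / L" and "0 \<le> t"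
      have "q * norm (\<sigma> t) \<le> V (\<sigma> 0)"
        using lower[of "\<sigma> t"] decr[of \<sigma> 0 t] \<sigma> \<open>0 \<le> t\<close> by linarith
      also have "\<dots> \<le> L * norm (\<sigma> 0)" by (rule upper)
      also have "\<dots> < q * \<epsilon>" using \<sigma> \<open>L > 0\<close> by (simp add: field_simps)
      finally show "norm (\<sigma> t) < \<epsilon>" using \<open>q > 0\<close> by simp
    qed
  qed
  moreover have "globally_attractive (\<lambda>y. A *v vec_sgn y)"
    unfolding globally_attractive_def
  proof (intro allI impI)
    fix \<sigma> assume sol: "filippov_solution (\<lambda>y. A *v vec_sgn y) \<sigma>"
    have "\<sigma> t = 0" if t: "t > V (\<sigma> 0) / c" for t
    proof -
      have "t > 0" using t Vnn[of "\<sigma> 0"] \<open>c > 0\<close> by (meson divide_nonneg_pos le_less_trans)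
      have "\<exists>s\<in>{0..t}. \<sigma> s = 0"
      proof (rule ccontr)
        assume nz: "\<not> (\<exists>s\<in>{0..t}. \<sigma> s = 0)"
        have "(\<Sum>i\<in>UNIV. p i * (v $ i * (A *v v) $ i)) \<le> - c"
          if "s \<in> {0..t}" "v \<in> sgn_set (\<sigma> s)" for s v
        proof -
          have "(norm v)\<^sup>2 \<ge> 1" using norm_sgn_set_ge_1[of "\<sigma> s" v] that nz by auto
          then have "- c * (norm v)\<^sup>2 \<le> - c" using \<open>c > 0\<close> by simp
          then show ?thesis using c[of v] by linarith
        qed
        then have "V (\<sigma> t) \<le> V (\<sigma> 0) - c * t"
          using filippov_sgn_weighted_l1_growth[OF sol, of 0 t p "- c"] \<open>t > 0\<close> by (simp add: V_def)
        moreover have "V (\<sigma> 0) < c * t" using t \<open>c > 0\<close> by (simp add: field_simps)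
        ultimately show False using Vnn[of "\<sigma> t"] by linarith
      qed
      then obtain s where "0 \<le> s" "s \<le> t" "\<sigma> s = 0" by auto
      then have "q * norm (\<sigma> t) \<le> 0"
        using decr[OF sol, of s t] lower[of "\<sigma> t"] V0 by simp
      then show ?thesis using \<open>q > 0\<close> by (simp add: mult_le_0_iff)
    qed
    then have "\<forall>\<^sub>F t in at_top. \<sigma> t = 0"
      by (meson eventually_at_top_dense)
    then show "(\<sigma> \<longlongrightarrow> 0) at_top" by (rule tendsto_eventually)
  qed
  ultimately show ?thesis by (simp add: globally_asymptotically_stable_def)
qed

section \<open>Consequences of the matrix inequality\<close>

lemma inner_block_matrix_mult:
  fixes x :: "real^'a" and y :: "real^'b"
  defines "z \<equiv> \<chi> k. case k of Inl i \<Rightarrow> x $ i | Inr j \<Rightarrow> y $ j"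
  shows "z \<bullet> (block_matrix P Q S T *v z) = x \<bullet> (P *v x) + x \<bullet> (Q *v y) + y \<bullet> (S *v x) + y \<bullet> (T *v y)"
proof -
  have sum_split: "(\<Sum>k\<in>UNIV. h k) = (\<Sum>i\<in>UNIV. h (Inl i)) + (\<Sum>j\<in>UNIV. h (Inr j))"
    for h :: "'a + 'b \<Rightarrow> real"
    by (simp add: UNIV_Plus_UNIV[symmetric] sum.Plus del: UNIV_Plus_UNIV)
  show ?thesis
    by (simp add: inner_vec_def matrix_vector_mult_def block_matrix_def z_def sum_split
        distrib_left sum.distrib)
qed

lemma
  assumes "neg_definite (block_matrix P Q S T)"
  shows neg_definite_block_upper: "x \<noteq> 0 \<Longrightarrow> x \<bullet> (P *v x) < 0"
    and neg_definite_block_lower: "y \<noteq> 0 \<Longrightarrow> y \<bullet> (T *v y) < 0"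
proof -
  have neg: "x \<bullet> (P *v x) + x \<bullet> (Q *v y) + y \<bullet> (S *v x) + y \<bullet> (T *v y) < 0" if "x \<noteq> 0 \<or> y \<noteq> 0" for x y
  proof -
    define z where "z = (\<chi> k. case k of Inl i \<Rightarrow> x $ i | Inr j \<Rightarrow> y $ j)"
    have "z $ Inl i = x $ i" "z $ Inr j = y $ j" for i j by (simp_all add: z_def)
    then have "z \<noteq> 0" using that by (metis vec_eq_iff zero_index)
    then have "z \<bullet> (block_matrix P Q S T *v z) < 0"
      using assms by (simp add: neg_definite_def)
    then show ?thesis unfolding z_def inner_block_matrix_mult .
  qed
  show "x \<bullet> (P *v x) < 0" if "x \<noteq> 0" using neg[of x 0] that by simp
  show "y \<bullet> (T *v y) < 0" if "y \<noteq> 0" using neg[of 0 y] that by simp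
qed

lemma convex_neg_form_matrices:
  "convex {B :: real^'m^'n. \<forall>x. x \<noteq> 0 \<longrightarrow> x \<bullet> ((B ** Z) *v x) < 0}"
proof (rule convexI, clarify)
  fix B C :: "real^'m^'n" and u v :: real and x :: "real^'n"
  assume B: "\<forall>x. x \<noteq> 0 \<longrightarrow> x \<bullet> ((B ** Z) *v x) < 0" and C: "\<forall>x. x \<noteq> 0 \<longrightarrow> x \<bullet> ((C ** Z) *v x) < 0"
    and uv: "0 \<le> u" "0 \<le> v" "u + v = 1" and "x \<noteq> 0"
  have "x \<bullet> (((u *\<^sub>R B + v *\<^sub>R C) ** Z) *v x)
      = u * (x \<bullet> ((B ** Z) *v x)) + v * (x \<bullet> ((C ** Z) *v x))"
    by (simp add: matrix_vector_mul_assoc[symmetric] matrix_vector_mult_add_rdistrib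
        scaleR_matrix_vector_assoc[symmetric] inner_add_right)
  also have "\<dots> < 0"
    using convex_bound_lt[of "x \<bullet> ((B ** Z) *v x)" 0 "x \<bullet> ((C ** Z) *v x)" u v] B C uv \<open>x \<noteq> 0\<close>
    by simp
  finally show "x \<bullet> (((u *\<^sub>R B + v *\<^sub>R C) ** Z) *v x) < 0" .
qed

lemma diagonal_matrix_vector_mult:
  assumes "diagonal_matrix X"
  shows "(X *v x) $ i = X $ i $ i * x $ i"
proof -
  have "(X *v x) $ i = (\<Sum>j\<in>UNIV. X $ i $ j * x $ j)"
    by (simp add: matrix_vector_mult_def)
  also have "\<dots> = (\<Sum>j\<in>{i}. X $ i $ j * x $ j)"
    using assms by (intro sum.mono_neutral_right) (auto simp: diagonal_matrix_def)
  finally show ?thesis by simp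
qed

lemma matrix_inv_vector_mult_right:
  fixes X :: "real^'n^'n"
  assumes "diagonal_matrix X" "\<And>i. X $ i $ i \<noteq> 0"
  shows "X *v (matrix_inv X *v v) = v"
proof -
  have "x = 0" if "X *v x = 0" for x
    using diagonal_matrix_vector_mult[OF assms(1), of x] that assms(2)
    by (metis mult_eq_0_iff vec_eq_iff zero_index)
  then have "invertible X"
    by (simp add: invertible_left_inverse matrix_left_invertible_ker)
  then have "X ** matrix_inv X = mat 1"
    unfolding invertible_def matrix_inv_def by (rule someI_ex[THEN conjunct1])
  then show ?thesis by (simp add: matrix_vector_mul_assoc)
qed

theorem theorem1:
  fixes B :: "nat \<Rightarrow> real^'m^'n" and N :: nat
    and W X R :: "real^'n^'n" and Z K :: "real^'n^'m"
    and \<xi> :: real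
  assumes "\<xi> > 0"
    and "diagonal_matrix W" and "diagonal_matrix X" and "symmetric_matrix R"
    and "pos_definite W" and "pos_definite R"
    and "\<forall>i\<in>{1..N}. neg_definite (block_matrix
           (B i ** Z + transpose Z ** transpose (B i) + R)  (W - X + \<xi> *\<^sub>R (transpose Z ** transpose (B i)))
           (W - X + \<xi> *\<^sub>R (B i ** Z))                       (- (2 * \<xi>) *\<^sub>R X))"
    and "K = Z ** matrix_inv X"
  shows "\<forall>B'\<in>convex hull (B ` {1..N}).
    globally_asymptotically_stable (\<lambda>\<sigma>. (B' ** K) *v vec_sgn \<sigma>)"
proof
  fix B' assume B': "B' \<in> convex hull (B ` {1..N})"
  note lmi = assms(7)[rule_format]
  have "x \<bullet> ((B i ** Z) *v x) < 0" if "i \<in> {1..N}" "x \<noteq> 0" for i x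
  proof -
    \<comment> \<open>The transposed product has the same quadratic form, so the upper left block carries it twice.\<close>
    have "x \<bullet> ((transpose Z ** transpose (B i)) *v x) = x \<bullet> ((B i ** Z) *v x)"
      by (metis dot_lmul_matrix inner_commute matrix_transpose_mul transpose_matrix_vector)
    moreover have "x \<bullet> (R *v x) > 0"
      using assms(6) \<open>x \<noteq> 0\<close> by (simp add: pos_definite_def)
    ultimately show ?thesis
      using neg_definite_block_upper[OF lmi[OF that(1)] that(2)]
      by (simp add: matrix_vector_mult_add_rdistrib inner_add_right)
  qed
  then have "convex hull (B ` {1..N}) \<subseteq> {B. \<forall>x. x \<noteq> 0 \<longrightarrow> x \<bullet> ((B ** Z) *v x) < 0}"
    by (intro hull_minimal convex_neg_form_matrices) auto
  with B' have neg: "x \<bullet> ((B' ** Z) *v x) < 0" if "x \<noteq> 0" for x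
    using that by blast
  have X: "X $ i $ i > 0" for i
  proof -
    \<comment> \<open>The hull contains \<open>B'\<close>, so there is at least one vertex whose inequality can be tested.\<close>
    obtain k where "k \<in> {1..N}" using B' by (metis convex_hull_empty empty_iff image_is_empty ex_in_conv)
    then have "axis i 1 \<bullet> ((- (2 * \<xi>) *\<^sub>R X) *v axis i 1) < 0"
      by (intro neg_definite_block_lower[OF lmi]) (auto simp: axis_eq_0_iff)
    moreover have "diagonal_matrix (- (2 * \<xi>) *\<^sub>R X)"
      using assms(3) by (simp add: diagonal_matrix_def)
    ultimately show ?thesis
      using \<open>\<xi> > 0\<close>
      by (simp add: inner_axis' diagonal_matrix_vector_mult zero_less_mult_iff del: scaleR_minus_left)
  qed
  show "globally_asymptotically_stable (\<lambda>\<sigma>. (B' ** K) *v vec_sgn \<sigma>)"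
  proof (rule diagonally_stable_relay_globally_asymptotically_stable)
    show "1 / X $ i $ i > 0" for i using X by simp
    fix v :: "real^'n" assume "v \<noteq> 0"
    \<comment> \<open>With weights \<open>1 / X\<^sub>i\<^sub>i\<close> and \<open>v = X x\<close>, the form in \<open>v\<close> becomes \<open>x \<bullet> (B' Z x)\<close>.\<close>
    define x where "x = matrix_inv X *v v"
    have v: "v = X *v x"
      unfolding x_def using matrix_inv_vector_mult_right[OF assms(3)] X by (metis less_irrefl)
    then have "x \<noteq> 0" using \<open>v \<noteq> 0\<close> by auto
    have "(B' ** K) *v v = (B' ** Z) *v x"
      by (simp add: assms(8) x_def matrix_vector_mul_assoc matrix_mul_assoc)
    moreover have "1 / X $ i $ i * (v $ i * d) = x $ i * d" for i d
      using X[of i] by (simp add: v diagonal_matrix_vector_mult[OF assms(3)])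
    ultimately have "(\<Sum>i\<in>UNIV. 1 / X $ i $ i * (v $ i * ((B' ** K) *v v) $ i)) = x \<bullet> ((B' ** Z) *v x)"
      by (simp add: inner_vec_def)
    then show "(\<Sum>i\<in>UNIV. 1 / X $ i $ i * (v $ i * ((B' ** K) *v v) $ i)) < 0"
      using neg[OF \<open>x \<noteq> 0\<close>] by simp
  qed
qed

end
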